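(* Let $X$ be a compact metric space with metric $d$. If a continuous map $f\colon X\to X$ has the shadowing property, then \[ V(f)=\{x\in X\colon C(x,f)\in\mathcal{C}_{\rm ter}(f)\} \] and \[ W(f)=\{x\in V(f)\colon \omega(x,f)=C(x,f)\} \] are dense $G_\delta$-subsets of $X$.
   Context: Let $(X,d)$ be a compact metric space and $f\colon X\to X$ a continuous map. Chains: for $\delta>0$, a finite sequence $(x_i)_{i=0}^k$ of points of $X$ with $k>0$ is a $\delta$-chain of $f$ if $d(f(x_i),x_{i+1})\le\delta$ for all $0\le i\le k-1$. For $x,y\in X$, write $x\rightarrow y$ if for every $\delta>0$ there is a $\delta$-chain $(x_i)_{i=0}^k$ of $f$ with $x_0=x$ and $x_k=y$. Chain components: the chain recurrent set is $CR(f)=\{x\in X\colon x\rightarrow x\}$. On $CR(f)$ the relation $x\leftrightarrow y$ (meaning $x\rightarrow y$ and $y\rightarrow x$) is an equivalence relation. Its equivalence classes are called chain components for $f$, and $\mathcal{C}(f)$ is the set of chain components. Each chain component $C$ is closed and satisfies $f(C)\subset C$. Terminal chain components: a closed set $S\subset X$ with $f(S)\subset S$ is chain stable if for every $\epsilon>0$ there is $\delta>0$ such that every $\delta$-chain $(x_i)_{i=0}^k$ of $f$ with $x_0\in S$ satisfies $d(x_i,S)\le\epsilon$ for all $0\le i\le k$. A chain component $C\in\mathcal{C}(f)$ is terminal if it is chain stable; $\mathcal{C}_{\rm ter}(f)$ is the set of terminal chain components. Limit sets: $\omega(x,f)$ is the set of $y\in X$ such that $\lim_{j\to\infty}f^{i_j}(x)=y$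 for some sequence $0\le i_1<i_2<\cdots$. For each $x\in X$, $C(x,f)$ denotes the unique chain component in $\mathcal{C}(f)$ with $\omega(x,f)\subset C(x,f)$ (such a chain component always exists and is unique). Shadowing: for $\delta>0$, a sequence $(x_i)_{i\ge0}$ in $X$ is a $\delta$-pseudo orbit of $f$ if $d(f(x_i),x_{i+1})\le\delta$ for all $i\ge0$; for $\epsilon>0$, it is $\epsilon$-shadowed by $x\in X$ if $d(f^i(x),x_i)\le\epsilon$ for all $i\ge0$. The map $f$ has the shadowing property if for every $\epsilon>0$ there is $\delta>0$ such that every $\delta$-pseudo orbit of $f$ is $\epsilon$-shadowed by some point of $X$. A $G_\delta$-subset is a countable intersection of open subsets. *)

theory Defs
  imports "HOL-Analysis.Analysis"
begin

text \<open>
  The phase space is a carrier set \<open>X\<close> in a type of class \<^class>\<open>metric_space\<close>, with the restricted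
  metric, and a self-map of \<open>X\<close> is a function on the ambient type mapping \<open>X\<close> into \<open>X\<close>; its values
  outside \<open>X\<close> are never used. A chain \<open>(x\<^sub>0, \<dots>, x\<^sub>k)\<close> is a function \<open>x\<close> on the naturals together
  with \<open>k\<close>; the values of \<open>x\<close> beyond \<open>k\<close> are irrelevant.
\<close>

definition delta_chain :: "'a::metric_space set \<Rightarrow> ('a \<Rightarrow> 'a) \<Rightarrow> real \<Rightarrow> (nat \<Rightarrow> 'a) \<Rightarrow> nat \<Rightarrow> bool"
  where "delta_chain X f \<delta> x k \<longleftrightarrow>
    k > 0 \<and> (\<forall>i\<le>k. x i \<in> X) \<and> (\<forall>i<k. dist (f (x i)) (x (Suc i)) \<le> \<delta>)"

definition chain_to :: "'a::metric_space set \<Rightarrow> ('a \<Rightarrow> 'a) \<Rightarrow> 'a \<Rightarrow> 'a \<Rightarrow> bool"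
  where "chain_to X f x y \<longleftrightarrow>
    (\<forall>\<delta>>0. \<exists>c k. delta_chain X f \<delta> c k \<and> c 0 = x \<and> c k = y)"

definition chain_recurrent_set :: "'a::metric_space set \<Rightarrow> ('a \<Rightarrow> 'a) \<Rightarrow> 'a set"
  where "chain_recurrent_set X f = {x \<in> X. chain_to X f x x}"

definition chain_equiv :: "'a::metric_space set \<Rightarrow> ('a \<Rightarrow> 'a) \<Rightarrow> ('a \<times> 'a) set"
  where "chain_equiv X f =
    {(x, y). x \<in> chain_recurrent_set X f \<and> y \<in> chain_recurrent_set X f \<and>
             chain_to X f x y \<and> chain_to X f y x}"

definition chain_components :: "'a::metric_space set \<Rightarrow> ('a \<Rightarrow> 'a) \<Rightarrow> 'a set set"
  where "chain_components X f = chain_recurrent_set X f // chain_equiv X f"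

text \<open>
  The distance from a point to \<open>S\<close> is \<^const>\<open>infdist\<close>, whose convention for the empty set plays no role
  since the chains considered start in \<open>S\<close>.
\<close>

definition chain_stable :: "'a::metric_space set \<Rightarrow> ('a \<Rightarrow> 'a) \<Rightarrow> 'a set \<Rightarrow> bool"
  where "chain_stable X f S \<longleftrightarrow>
    closedin (top_of_set X) S \<and> f ` S \<subseteq> S \<and>
    (\<forall>\<epsilon>>0. \<exists>\<delta>>0. \<forall>x k. delta_chain X f \<delta> x k \<and> x 0 \<in> S \<longrightarrow> (\<forall>i\<le>k. infdist (x i) S \<le> \<epsilon>))"

definition terminal_components :: "'a::metric_space set \<Rightarrow> ('a \<Rightarrow> 'a) \<Rightarrow> 'a set set"
  where "terminal_components X f = {C \<in> chain_components X f. chain_stable X f C}"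

definition omega_limit :: "'a::metric_space set \<Rightarrow> ('a \<Rightarrow> 'a) \<Rightarrow> 'a \<Rightarrow> 'a set"
  where "omega_limit X f x =
    {y \<in> X. \<exists>i :: nat \<Rightarrow> nat. strict_mono i \<and> (\<lambda>j. (f ^^ i j) x) \<longlonglongrightarrow> y}"

text \<open>
  For \<open>X\<close> compact, \<open>f\<close> a continuous self-map of \<open>X\<close> and \<open>x \<in> X\<close>, exactly one chain component
  contains the omega-limit set of \<open>x\<close>, so the description below is meaningful.
\<close>

definition component_of_point :: "'a::metric_space set \<Rightarrow> ('a \<Rightarrow> 'a) \<Rightarrow> 'a \<Rightarrow> 'a set"
  where "component_of_point X f x =
    (THE C. C \<in> chain_components X f \<and> omega_limit X f x \<subseteq> C)"

definition pseudo_orbit :: "'a::metric_space set \<Rightarrow> ('a \<Rightarrow> 'a) \<Rightarrow> real \<Rightarrow> (nat \<Rightarrow> 'a) \<Rightarrow> bool"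
  where "pseudo_orbit X f \<delta> x \<longleftrightarrow>
    (\<forall>i. x i \<in> X) \<and> (\<forall>i. dist (f (x i)) (x (Suc i)) \<le> \<delta>)"

definition shadowed_by :: "('a::metric_space \<Rightarrow> 'a) \<Rightarrow> real \<Rightarrow> (nat \<Rightarrow> 'a) \<Rightarrow> 'a \<Rightarrow> bool"
  where "shadowed_by f \<epsilon> x p \<longleftrightarrow> (\<forall>i. dist ((f ^^ i) p) (x i) \<le> \<epsilon>)"

definition shadowing_property :: "'a::metric_space set \<Rightarrow> ('a \<Rightarrow> 'a) \<Rightarrow> bool"
  where "shadowing_property X f \<longleftrightarrow>
    (\<forall>\<epsilon>>0. \<exists>\<delta>>0. \<forall>x. pseudo_orbit X f \<delta> x \<longrightarrow> (\<exists>p\<in>X. shadowed_by f \<epsilon> x p))"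

definition V_set :: "'a::metric_space set \<Rightarrow> ('a \<Rightarrow> 'a) \<Rightarrow> 'a set"
  where "V_set X f = {x \<in> X. component_of_point X f x \<in> terminal_components X f}"

definition W_set :: "'a::metric_space set \<Rightarrow> ('a \<Rightarrow> 'a) \<Rightarrow> 'a set"
  where "W_set X f = {x \<in> V_set X f. omega_limit X f x = component_of_point X f x}"

end

theory Submission
  imports Defs
begin

text \<open>
  Write \<open>x \<leadsto> y\<close> for the chain relation and \<open>reachable y = {z. y \<leadsto> z}\<close>. The relation is
  transitive and closed, all points of the omega-limit set of \<open>x\<close> lead to each other, and the
  component \<open>C(x, f)\<close> is the class of any \<open>y\<close> among them. This class is terminal exactly when
  nothing else can be reached from \<open>y\<close>, that is, when every \<open>z\<close> with \<open>y \<leadsto> z\<close> leads back to \<open>y\<close>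
  (\<open>terminal_component_iff\<close>); and \<open>x\<close> belongs to \<open>W(f)\<close> exactly when
  \<open>reachable y\<close> is contained in the omega-limit set of \<open>x\<close> (\<open>W_set_iff\<close>).

  Both conditions are limits of conditions on a single iterate of \<open>x\<close>. The point \<open>x\<close> belongs to
  \<open>V(f)\<close> iff, at every scale \<open>\<epsilon>\<close>, some iterate \<open>p\<close> of \<open>x\<close> can be returned to by an \<open>\<epsilon>\<close>-chain from
  each end point of a \<open>\<delta>\<close>-chain starting at \<open>p\<close>, for some \<open>\<delta>\<close>; it belongs to \<open>W(f)\<close> iff each such
  end point is \<open>\<epsilon>\<close>-close to late iterates of \<open>x\<close>. What makes these conditions hold on whole
  neighbourhoods is the upper semicontinuity of \<open>reachable\<close>, a consequence of compactness: if the
  orbit of \<open>x\<close> comes close to \<open>y\<close>, then chains with small jumps that start there stay close to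
  \<open>reachable y\<close>. Hence both sets are countable intersections of interiors
  (\<open>V_set_eq\<close>, \<open>W_set_eq\<close>).

  For density, Zorn's lemma gives a terminal component reachable from an arbitrary \<open>x\<close>: a minimal
  set of the form \<open>reachable y\<close>. A chain from \<open>x\<close> to \<open>y\<close> that then tours a finite net of this
  component is shadowed by an orbit that starts near \<open>x\<close>, and coming close to \<open>y\<close> and to the points
  of the net is enough to lie in the interior of the \<open>n\<close>-th condition defining \<open>W(f)\<close>. These
  interiors are therefore dense, and Baire's theorem makes \<open>W(f)\<close> dense, and with it the larger
  set \<open>V(f)\<close>. The orbit found by shadowing need not itself have its limit set in the component,
  which is why Baire's theorem enters.
\<close>

section \<open>Chains of a compact system\<close>

locale compact_system =
  fixes X :: "'a::metric_space set" and f :: "'a \<Rightarrow> 'a"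
  assumes compact_X: "compact X"
    and continuous_f: "continuous_on X f"
    and maps_into: "f ` X \<subseteq> X"
begin

definition reach :: "real \<Rightarrow> 'a \<Rightarrow> 'a \<Rightarrow> bool"
  where "reach \<delta> x y \<longleftrightarrow> (\<exists>c k. delta_chain X f \<delta> c k \<and> c 0 = x \<and> c k = y)"

abbreviation leads_to :: "'a \<Rightarrow> 'a \<Rightarrow> bool"  (infix "\<leadsto>" 50)
  where "x \<leadsto> y \<equiv> chain_to X f x y"

lemma leads_to_iff: "x \<leadsto> y \<longleftrightarrow> (\<forall>\<delta>>0. reach \<delta> x y)"
  by (simp add: chain_to_def reach_def)

lemma chain_concat:
  assumes "delta_chain X f \<delta> c k" "delta_chain X f \<delta> d l" "c k = d 0"
  shows "delta_chain X f \<delta> (\<lambda>i. if i \<le> k then c i else d (i - k)) (k + l)"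
  unfolding delta_chain_def
proof (intro conjI allI impI)
  show "0 < k + l" using assms by (simp add: delta_chain_def)
next
  fix i assume "i \<le> k + l"
  then show "(if i \<le> k then c i else d (i - k)) \<in> X"
    using assms by (auto simp: delta_chain_def)
next
  fix i assume i: "i < k + l"
  consider "i < k" | "i = k" | "i > k" by linarith
  then show "dist (f (if i \<le> k then c i else d (i - k)))
                  (if Suc i \<le> k then c (Suc i) else d (Suc i - k)) \<le> \<delta>"
  proof cases
    case 1 then show ?thesis using assms by (auto simp: delta_chain_def)
  next
    case 2
    have "dist (f (d 0)) (d (Suc 0)) \<le> \<delta>"
      using assms(2) by (auto simp: delta_chain_def)
    then show ?thesis using 2 assms(3) by simp
  next
    case 3
    then have "i - k < l" "Suc i - k = Suc (i - k)" using i by auto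
    then show ?thesis using 3 assms(2) by (auto simp: delta_chain_def)
  qed
qed

lemma reach_trans: "reach \<delta> x y \<Longrightarrow> reach \<delta> y z \<Longrightarrow> reach \<delta> x z"
  unfolding reach_def
proof (elim exE conjE)
  fix c k d l
  assume a: "delta_chain X f \<delta> c k" "c 0 = x" "c k = y" "delta_chain X f \<delta> d l" "d 0 = y" "d l = z"
  have "l > 0" using a by (simp add: delta_chain_def)
  then show "\<exists>c k. delta_chain X f \<delta> c k \<and> c 0 = x \<and> c k = z"
    using a chain_concat[of \<delta> c k d l]
    by (intro exI[of _ "\<lambda>i. if i \<le> k then c i else d (i - k)"] exI[of _ "k + l"]) auto
qed

lemma leads_to_trans: "x \<leadsto> y \<Longrightarrow> y \<leadsto> z \<Longrightarrow> x \<leadsto> z"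
  unfolding leads_to_iff by (blast intro: reach_trans)

lemma reach_in: assumes "reach \<delta> x y" shows "x \<in> X" "y \<in> X"
  using assms by (auto simp: reach_def delta_chain_def)

lemma leads_to_in: assumes "x \<leadsto> y" shows "x \<in> X" "y \<in> X"
  using assms reach_in[of 1 x y] by (auto simp: leads_to_iff)

lemma reach_mono:
  assumes "reach \<delta> x y" "\<delta> \<le> \<delta>'"
  shows "reach \<delta>' x y"
proof -
  obtain c k where "delta_chain X f \<delta> c k" "c 0 = x" "c k = y"
    using assms(1) by (auto simp: reach_def)
  moreover from this(1) have "delta_chain X f \<delta>' c k"
    using assms(2) by (force simp: delta_chain_def)
  ultimately show ?thesis unfolding reach_def by blast
qed

lemma reach_perturb_start:
  assumes "reach \<delta> p z" "q \<in> X" "dist (f q) (f p) \<le> \<eta>" "\<eta> \<ge> 0"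
  shows "reach (\<delta> + \<eta>) q z"
proof -
  obtain c k where c: "k > 0" "\<forall>i\<le>k. c i \<in> X" "\<forall>i<k. dist (f (c i)) (c (Suc i)) \<le> \<delta>"
    "c 0 = p" "c k = z"
    using assms(1) by (auto simp: reach_def delta_chain_def)
  have "delta_chain X f (\<delta> + \<eta>) (c(0 := q)) k"
    unfolding delta_chain_def
  proof (intro conjI allI impI)
    fix i assume i: "i < k"
    have le: "dist (f (c i)) (c (Suc i)) \<le> \<delta>" using c i by blast
    show "dist (f ((c(0 := q)) i)) ((c(0 := q)) (Suc i)) \<le> \<delta> + \<eta>"
    proof (cases "i = 0")
      case True
      then have "dist (f q) (c (Suc 0)) \<le> dist (f q) (f p) + dist (f p) (c (Suc 0))"
        by (intro dist_triangle)
      then show ?thesis using True le c(4) assms(3) by simp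
    next
      case False then show ?thesis using le assms(4) by simp
    qed
  qed (use c assms(2) in auto)
  then show ?thesis unfolding reach_def
    by (intro exI[of _ "c(0 := q)"] exI[of _ k]) (use c in auto)
qed

lemma reach_perturb_end:
  assumes "reach \<delta> p z" "w \<in> X" "dist z w \<le> \<eta>" "\<eta> \<ge> 0"
  shows "reach (\<delta> + \<eta>) p w"
proof -
  obtain c k where c: "k > 0" "\<forall>i\<le>k. c i \<in> X" "\<forall>i<k. dist (f (c i)) (c (Suc i)) \<le> \<delta>"
    "c 0 = p" "c k = z"
    using assms(1) by (auto simp: reach_def delta_chain_def)
  have "delta_chain X f (\<delta> + \<eta>) (c(k := w)) k"
    unfolding delta_chain_def
  proof (intro conjI allI impI)
    fix i assume i: "i < k"
    have le: "dist (f (c i)) (c (Suc i)) \<le> \<delta>" using c i by blast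
    show "dist (f ((c(k := w)) i)) ((c(k := w)) (Suc i)) \<le> \<delta> + \<eta>"
    proof (cases "Suc i = k")
      case True
      then have "dist (f (c i)) w \<le> dist (f (c i)) z + dist z w"
        by (intro dist_triangle)
      then show ?thesis using True le c(5) assms(3) i by auto
    next
      case False then show ?thesis using le assms(4) i by simp
    qed
  qed (use c assms(2) in auto)
  then show ?thesis unfolding reach_def
    by (intro exI[of _ "c(k := w)"] exI[of _ k]) (use c in auto)
qed

lemma uniform_modulus:
  assumes "\<epsilon> > 0"
  obtains \<eta> where "\<eta> > 0" "\<eta> \<le> \<epsilon>" "\<And>p q. p \<in> X \<Longrightarrow> q \<in> X \<Longrightarrow> dist p q < \<eta> \<Longrightarrow> dist (f p) (f q) \<le> \<epsilon>"
proof -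
  have "uniformly_continuous_on X f"
    using compact_uniformly_continuous continuous_f compact_X by blast
  then obtain d where "d > 0" "\<forall>x\<in>X. \<forall>x'\<in>X. dist x' x < d \<longrightarrow> dist (f x') (f x) < \<epsilon>"
    using assms unfolding uniformly_continuous_on_def by metis
  then show ?thesis
    using assms by (intro that[of "min d \<epsilon>"]) (auto intro: less_imp_le)
qed

text \<open>
  Chains ending at nearby points can have their end points moved, at the cost of slightly larger
  jumps at the first and the last step. In particular the relation \<open>\<leadsto>\<close> is closed.
\<close>

lemma leads_to_limit:
  assumes "y \<in> X" "z \<in> X"
    and approx: "\<And>\<eta>. \<eta> > 0 \<Longrightarrow> \<exists>p w. dist p y < \<eta> \<and> dist w z < \<eta> \<and> reach \<eta> p w"
  shows "y \<leadsto> z"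
  unfolding leads_to_iff
proof (intro allI impI)
  fix \<delta> :: real assume "\<delta> > 0"
  then obtain \<eta> where \<eta>: "\<eta> > 0" "\<eta> \<le> \<delta>/3"
    "\<And>p q. p \<in> X \<Longrightarrow> q \<in> X \<Longrightarrow> dist p q < \<eta> \<Longrightarrow> dist (f p) (f q) \<le> \<delta>/3"
    using uniform_modulus[of "\<delta>/3"] by auto
  obtain p w where pw: "dist p y < \<eta>" "dist w z < \<eta>" "reach \<eta> p w" using approx \<eta>(1) by blast
  have "reach (\<eta> + \<delta>/3) y w"
    using pw \<eta>(3)[of y p] \<open>\<delta> > 0\<close> assms(1) reach_in[OF pw(3)]
    by (intro reach_perturb_start[OF pw(3)]) (auto simp: dist_commute)
  then have "reach (\<eta> + \<delta>/3 + \<eta>) y z"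
    by (rule reach_perturb_end) (use pw(2) \<eta>(1) assms(2) in auto)
  then show "reach \<delta> y z" by (rule reach_mono) (use \<eta>(2) in simp)
qed

section \<open>Orbits and limit sets\<close>

lemma iterate_in: "x \<in> X \<Longrightarrow> (f ^^ n) x \<in> X"
  using maps_into by (induction n) auto

lemma continuous_iterate: "continuous_on X (f ^^ n)"
proof (induction n)
  case (Suc n)
  have "continuous_on X (f \<circ> (f ^^ n))"
    using iterate_in by (intro continuous_on_compose Suc continuous_on_subset[OF continuous_f]) auto
  then show ?case by simp
qed (simp add: continuous_on_id)

lemma reach_iterate:
  assumes "x \<in> X" "n > 0" "\<delta> \<ge> 0"
  shows "reach \<delta> x ((f ^^ n) x)"
  unfolding reach_def delta_chain_def
  by (intro exI[of _ "\<lambda>i. (f ^^ i) x"] exI[of _ n]) (use assms iterate_in in auto)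

lemma reach_later_iterate:
  assumes "x \<in> X" "m < n" "\<delta> \<ge> 0"
  shows "reach \<delta> ((f ^^ m) x) ((f ^^ n) x)"
proof -
  have "(f ^^ n) x = (f ^^ (n - m)) ((f ^^ m) x)"
    using assms(2) by (simp flip: funpow_add comp_apply[of "f ^^ (n - m)" "f ^^ m"])
  then show ?thesis
    using reach_iterate[of "(f ^^ m) x" "n - m" \<delta>] assms iterate_in by simp
qed

lemma leads_to_image: "x \<in> X \<Longrightarrow> x \<leadsto> f x"
  using reach_iterate[of x 1] by (auto simp: leads_to_iff)

lemma omega_limit_iff:
  "y \<in> omega_limit X f x \<longleftrightarrow> y \<in> X \<and> (\<forall>\<epsilon>>0. \<forall>n. \<exists>m\<ge>n. dist ((f ^^ m) x) y < \<epsilon>)"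
proof (intro iffI conjI allI impI)
  assume "y \<in> omega_limit X f x"
  then obtain i where i: "y \<in> X" "strict_mono i" "(\<lambda>j. (f ^^ i j) x) \<longlonglongrightarrow> y"
    by (auto simp: omega_limit_def)
  then show "y \<in> X" by blast
  fix \<epsilon> :: real and n :: nat assume "\<epsilon> > 0"
  then obtain J where "\<forall>j\<ge>J. dist ((f ^^ i j) x) y < \<epsilon>"
    using i(3) unfolding lim_sequentially by blast
  then have "dist ((f ^^ i (max J n)) x) y < \<epsilon>" by simp
  moreover have "n \<le> i (max J n)"
    using seq_suble[OF i(2), of "max J n"] by simp
  ultimately show "\<exists>m\<ge>n. dist ((f ^^ m) x) y < \<epsilon>" by blast
next
  assume *: "y \<in> X \<and> (\<forall>\<epsilon>>0. \<forall>n. \<exists>m\<ge>n. dist ((f ^^ m) x) y < \<epsilon>)"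
  have "\<exists>i. \<forall>n. dist ((f ^^ i n) x) y < inverse (real (Suc n)) \<and> i n < i (Suc n)"
  proof (rule dependent_nat_choice)
    show "\<exists>m. dist ((f ^^ m) x) y < inverse (real (Suc 0))"
      using * by (metis inverse_1 of_nat_1 One_nat_def zero_less_one)
    fix m n
    have "inverse (real (Suc (Suc n))) > 0" by simp
    then show "\<exists>m'. dist ((f ^^ m') x) y < inverse (real (Suc (Suc n))) \<and> m < m'"
      using * by (meson Suc_le_eq)
  qed
  then obtain i where i: "\<And>n. dist ((f ^^ i n) x) y < inverse (real (Suc n))" "\<And>n. i n < i (Suc n)"
    by blast
  have "strict_mono i" using i(2) by (simp add: strict_mono_Suc_iff)
  moreover have "(\<lambda>j. (f ^^ i j) x) \<longlonglongrightarrow> y"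
  proof (rule metric_LIMSEQ_I)
    fix r :: real assume "r > 0"
    then obtain N where N: "inverse (real (Suc N)) < r" using reals_Archimedean by blast
    have "dist ((f ^^ i n) x) y < r" if "n \<ge> N" for n
    proof -
      have "inverse (real (Suc n)) \<le> inverse (real (Suc N))" using that by simp
      then show ?thesis using i(1)[of n] N by linarith
    qed
    then show "\<exists>no. \<forall>n\<ge>no. dist ((f ^^ i n) x) y < r" by blast
  qed
  ultimately show "y \<in> omega_limit X f x" using * by (auto simp: omega_limit_def)
qed

lemma omega_limit_nonempty:
  assumes "x \<in> X"
  shows "omega_limit X f x \<noteq> {}"
proof -
  have "\<forall>n. (f ^^ n) x \<in> X" using assms iterate_in by blast
  then obtain l r where "l \<in> X" "strict_mono r" "((\<lambda>n. (f ^^ n) x) \<circ> r) \<longlonglongrightarrow> l"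
    using compact_X unfolding compact_def by metis
  then show ?thesis by (auto simp: omega_limit_def comp_def)
qed

lemma iterate_leads_to_omega_limit:
  assumes "x \<in> X" "y \<in> omega_limit X f x"
  shows "(f ^^ n) x \<leadsto> y"
proof (rule leads_to_limit)
  fix \<eta> :: real assume \<eta>: "\<eta> > 0"
  then obtain m where m: "m \<ge> Suc n" "dist ((f ^^ m) x) y < \<eta>"
    using assms by (meson omega_limit_iff)
  have "reach \<eta> ((f ^^ n) x) ((f ^^ m) x)" using m \<eta> assms reach_later_iterate by simp
  then show "\<exists>p w. dist p ((f ^^ n) x) < \<eta> \<and> dist w y < \<eta> \<and> reach \<eta> p w"
    using m(2) \<eta> by (metis dist_self)
qed (use assms iterate_in omega_limit_iff in auto)

lemma omega_limit_points_lead_to_each_other: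
  assumes "x \<in> X" "y \<in> omega_limit X f x" "z \<in> omega_limit X f x"
  shows "y \<leadsto> z"
proof (rule leads_to_limit)
  fix \<eta> :: real assume \<eta>: "\<eta> > 0"
  then obtain n where n: "dist ((f ^^ n) x) y < \<eta>"
    using assms by (meson omega_limit_iff)
  have "reach \<eta> ((f ^^ n) x) z"
    using iterate_leads_to_omega_limit assms \<eta> leads_to_iff by blast
  then show "\<exists>p w. dist p y < \<eta> \<and> dist w z < \<eta> \<and> reach \<eta> p w"
    using n \<eta> by (metis dist_self)
qed (use assms omega_limit_iff in auto)

section \<open>Reachable sets\<close>

definition reachable :: "'a \<Rightarrow> 'a set"
  where "reachable y = {z. y \<leadsto> z}"

lemma reachable_subset: "reachable y \<subseteq> X"
  using leads_to_in by (auto simp: reachable_def)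

lemma closed_reachable: "closed (reachable y)"
proof (cases "y \<in> X")
  case True
  have "closure (reachable y) \<subseteq> reachable y"
  proof
    fix z assume z: "z \<in> closure (reachable y)"
    have "closure (reachable y) \<subseteq> X"
      using reachable_subset compact_imp_closed[OF compact_X] by (rule closure_minimal)
    with z have "z \<in> X" by blast
    moreover have "\<exists>p w. dist p y < \<eta> \<and> dist w z < \<eta> \<and> reach \<eta> p w" if "\<eta> > 0" for \<eta>
      using z that unfolding closure_approachable
      by (metis dist_self leads_to_iff mem_Collect_eq reachable_def)
    ultimately show "z \<in> reachable y"
      using leads_to_limit[OF True] by (auto simp: reachable_def)
  qed
  then show ?thesis by (simp add: closure_subset_eq)
next
  case False
  then have "reachable y = {}" using leads_to_in by (auto simp: reachable_def)
  then show ?thesis by simp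
qed

lemma compact_reachable: "compact (reachable y)"
  using compact_Int_closed[OF compact_X closed_reachable[of y]] reachable_subset[of y]
  by (simp add: Int_absorb1)

text \<open>
  Upper semicontinuity of the reachable sets. Otherwise chains with ever smaller jumps would start
  ever closer to \<open>K\<close> and end away from every point reachable from \<open>K\<close>; a limit of their end points
  is reachable from a limit of their starting points.
\<close>

lemma reachable_upper_semicontinuous:
  assumes "compact K" "K \<subseteq> X" "\<epsilon> > 0"
  obtains \<eta> where "\<eta> > 0"
    "\<And>y p z. y \<in> K \<Longrightarrow> dist p y < \<eta> \<Longrightarrow> reach \<eta> p z \<Longrightarrow> \<exists>y'\<in>K. \<exists>c\<in>reachable y'. dist z c < \<epsilon>"
proof (rule ccontr)
  note witness = that
  assume neg: "\<not> thesis"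
  have "\<exists>y p z. y \<in> K \<and> dist p y < \<eta> \<and> reach \<eta> p z \<and> (\<forall>y'\<in>K. \<forall>c\<in>reachable y'. \<epsilon> \<le> dist z c)"
    if "\<eta> > 0" for \<eta>
    using neg witness[of \<eta>] \<open>\<eta> > 0\<close> by (meson not_le)
  then have "\<forall>n. \<exists>y p z. y \<in> K \<and> dist p y < inverse (real (Suc n)) \<and> reach (inverse (real (Suc n))) p z
      \<and> (\<forall>y'\<in>K. \<forall>c\<in>reachable y'. \<epsilon> \<le> dist z c)"
    by (metis inverse_positive_iff_positive of_nat_0_less_iff zero_less_Suc)
  then obtain y p z where
    y: "\<And>n. y n \<in> K" and p: "\<And>n. dist (p n) (y n) < inverse (real (Suc n))"
    and r: "\<And>n. reach (inverse (real (Suc n))) (p n) (z n)"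
    and far: "\<And>n y' c. y' \<in> K \<Longrightarrow> c \<in> reachable y' \<Longrightarrow> \<epsilon> \<le> dist (z n) c"
    by metis
  obtain l s where l: "l \<in> K" "strict_mono s" "(y \<circ> s) \<longlonglongrightarrow> l"
    using y assms(1) unfolding compact_def by metis
  have "\<forall>n. (z \<circ> s) n \<in> X" using r reach_in(2) by (metis comp_apply)
  then obtain w t where w: "w \<in> X" "strict_mono t" "(z \<circ> s \<circ> t) \<longlonglongrightarrow> w"
    using compact_X unfolding compact_def by metis
  have "(\<lambda>n. y (s (t n))) \<longlonglongrightarrow> l"
    using LIMSEQ_subseq_LIMSEQ[OF l(3) w(2)] by (simp add: comp_def)
  have st: "n \<le> s (t n)" for n
    using seq_suble[OF l(2)] seq_suble[OF w(2)] le_trans by blast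
  have close: "\<exists>n. dist (y n) l < \<eta>/2 \<and> dist (z n) w < \<eta> \<and> inverse (real (Suc n)) < \<eta>/2"
    if \<eta>: "\<eta> > 0" for \<eta>
  proof -
    obtain N1 where N1: "\<forall>n\<ge>N1. dist (y (s (t n))) l < \<eta>/2"
      using metric_LIMSEQ_D[OF \<open>(\<lambda>n. y (s (t n))) \<longlonglongrightarrow> l\<close>, of "\<eta>/2"] \<eta> by auto
    obtain N2 where N2: "\<forall>n\<ge>N2. dist (z (s (t n))) w < \<eta>"
      using metric_LIMSEQ_D[OF w(3) \<eta>] by auto
    obtain N3 where N3: "inverse (real (Suc N3)) < \<eta>/2"
      using reals_Archimedean[of "\<eta>/2"] \<eta> by auto
    define n where "n = max N1 (max N2 N3)"
    have "inverse (real (Suc (s (t n)))) \<le> inverse (real (Suc N3))"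
      using st[of n] by (intro le_imp_inverse_le) (auto simp: n_def)
    then have "inverse (real (Suc (s (t n)))) < \<eta>/2" using N3 by linarith
    moreover have "dist (y (s (t n))) l < \<eta>/2" "dist (z (s (t n))) w < \<eta>"
      using N1 N2 by (simp_all add: n_def)
    ultimately show ?thesis by blast
  qed
  have "l \<leadsto> w"
  proof (rule leads_to_limit)
    fix \<eta> :: real assume \<eta>: "\<eta> > 0"
    then obtain n where n: "dist (y n) l < \<eta>/2" "dist (z n) w < \<eta>" "inverse (real (Suc n)) < \<eta>/2"
      using close by blast
    have "dist (p n) l < \<eta>" using dist_triangle[of "p n" l "y n"] p[of n] n by linarith
    moreover have "reach \<eta> (p n) (z n)" using r[of n] by (rule reach_mono) (use n \<eta> in linarith)
    ultimately show "\<exists>p w'. dist p l < \<eta> \<and> dist w' w < \<eta> \<and> reach \<eta> p w'" using n by blast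
  qed (use l w assms in auto)
  then have "\<epsilon> \<le> dist (z n) w" for n using far l by (auto simp: reachable_def)
  then show False using close[OF assms(3)] by (meson not_le)
qed

section \<open>Terminal components\<close>

text \<open>
  Terminality of a component, expressed by one of its points.
\<close>

definition terminal_point :: "'a \<Rightarrow> bool"
  where "terminal_point y \<longleftrightarrow> y \<in> X \<and> (\<forall>z\<in>reachable y. z \<leadsto> y)"

lemma terminal_point_recurrent:
  assumes "terminal_point y"
  shows "y \<leadsto> y"
  using assms leads_to_image[of y] leads_to_trans
  unfolding terminal_point_def reachable_def by blast

text \<open>
  Among the sets reachable from points of \<open>reachable x\<close> there is a minimal one, by Zorn's lemma and
  compactness. Each of its points reaches the same set again, hence reaches every other point of it.
\<close>

lemma terminal_point_reachable:
  assumes "x \<in> X"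
  obtains y where "x \<leadsto> y" "terminal_point y"
proof -
  define A where "A = (\<lambda>y. - reachable y) ` reachable x"
  have "\<exists>M\<in>A. \<forall>U\<in>A. M \<subseteq> U \<longrightarrow> U = M"
  proof (rule subset_Zorn)
    fix C assume C: "subset.chain A C"
    have "X \<inter> \<Inter>(uminus ` C) \<inter> reachable x \<noteq> {}"
    proof (cases "C = {}")
      case True
      have "f x \<in> X \<inter> reachable x"
        using leads_to_image[OF assms] leads_to_in(2) by (auto simp: reachable_def)
      then show ?thesis using True by auto
    next
      case False
      have "X \<inter> \<Inter>(uminus ` C) \<noteq> {}"
      proof (rule compact_imp_fip[OF compact_X])
        fix T assume "T \<in> uminus ` C"
        then obtain y where "T = reachable y"
          using C by (auto simp: subset_chain_def A_def)
        then show "closed T" by (simp add: closed_reachable)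
      next
        fix F assume F: "finite F" "F \<subseteq> uminus ` C"
        then obtain B where B: "B \<subseteq> C" "finite B" "F = uminus ` B"
          by (meson finite_subset_image)
        show "X \<inter> \<Inter>F \<noteq> {}"
        proof (cases "B = {}")
          case True
          then show ?thesis using B assms by auto
        next
          case False
          have "subset.chain A B"
            using C B(1) unfolding subset_chain_def by (meson order_trans subsetD)
          then have "\<Union>B \<in> A"
            using Union_in_chain[OF B(2) False] by (auto simp: subset_chain_def)
          then obtain y where y: "y \<in> reachable x" "\<Union>B = - reachable y" by (auto simp: A_def)
          then have "\<Inter>F = reachable y" using B(3) by auto
          moreover have "f y \<in> reachable y \<inter> X"
            using leads_to_image[of y] y(1) leads_to_in by (auto simp: reachable_def)
          ultimately show ?thesis by blast
        qed
      qed
      moreover have "\<Inter>(uminus ` C) \<subseteq> reachable x"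
      proof -
        obtain U where "U \<in> C" using False by blast
        then obtain y where "y \<in> reachable x" "U = - reachable y"
          using C by (auto simp: subset_chain_def A_def)
        then have "- U \<subseteq> reachable x" using leads_to_trans by (auto simp: reachable_def)
        then show ?thesis using \<open>U \<in> C\<close> by blast
      qed
      ultimately show ?thesis by blast
    qed
    then obtain w where w: "w \<in> reachable x" "\<And>U. U \<in> C \<Longrightarrow> w \<notin> U" by blast
    have "\<forall>U\<in>C. U \<subseteq> - reachable w"
    proof
      fix U assume U: "U \<in> C"
      then obtain y where y: "U = - reachable y" using C by (auto simp: subset_chain_def A_def)
      then have "reachable w \<subseteq> reachable y"
        using w(2)[OF U] leads_to_trans by (auto simp: reachable_def)
      then show "U \<subseteq> - reachable w" using y by blast
    qed
    then show "\<exists>M\<in>A. \<forall>U\<in>C. U \<subseteq> M" using w(1) by (auto simp: A_def)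
  qed
  then obtain y where y: "y \<in> reachable x"
    "\<And>z. z \<in> reachable x \<Longrightarrow> reachable z \<subseteq> reachable y \<Longrightarrow> reachable z = reachable y"
    unfolding A_def by auto
  have eq: "reachable z = reachable y" if "z \<in> reachable y" for z
    using that y leads_to_trans by (auto simp: reachable_def)
  \<comment> \<open>The point \<open>y\<close> itself need not lie in the minimal set \<open>reachable y\<close>, but \<open>f y\<close> does.\<close>
  have fy: "f y \<in> reachable y"
    using leads_to_image[of y] y(1) leads_to_in by (auto simp: reachable_def)
  have "terminal_point (f y)"
    unfolding terminal_point_def
  proof (intro conjI ballI)
    show "f y \<in> X" using fy reachable_subset by blast
    fix z assume "z \<in> reachable (f y)"
    then have "reachable z = reachable y" using eq fy by blast
    then show "z \<leadsto> f y" using fy by (auto simp: reachable_def)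
  qed
  moreover have "x \<leadsto> f y" using y(1) fy leads_to_trans by (auto simp: reachable_def)
  ultimately show ?thesis using that by blast
qed

lemma chain_equiv_iff: "(x, y) \<in> chain_equiv X f \<longleftrightarrow> x \<leadsto> y \<and> y \<leadsto> x"
proof
  assume "x \<leadsto> y \<and> y \<leadsto> x"
  moreover from this have "x \<leadsto> x" "y \<leadsto> y" "x \<in> X" "y \<in> X"
    using leads_to_trans[of x y x] leads_to_trans[of y x y] leads_to_in[of x y] by blast+
  ultimately show "(x, y) \<in> chain_equiv X f"
    by (simp add: chain_equiv_def chain_recurrent_set_def)
qed (simp add: chain_equiv_def)

lemma equiv_chain_equiv: "equiv (chain_recurrent_set X f) (chain_equiv X f)"
proof (rule equivI)
  show "chain_equiv X f \<subseteq> chain_recurrent_set X f \<times> chain_recurrent_set X f"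
    by (auto simp: chain_equiv_def)
  show "refl_on (chain_recurrent_set X f) (chain_equiv X f)"
    by (auto simp: refl_on_def chain_equiv_def chain_recurrent_set_def)
  show "sym (chain_equiv X f)"
    by (auto simp: chain_equiv_iff intro: symI)
  show "trans (chain_equiv X f)"
    by (rule transI) (meson chain_equiv_iff leads_to_trans)
qed

lemma chain_class_eq: "chain_equiv X f `` {y} = {z. y \<leadsto> z \<and> z \<leadsto> y}"
  using chain_equiv_iff by blast

lemma component_of_point_eq:
  assumes "x \<in> X" "y \<in> omega_limit X f x"
  shows "component_of_point X f x = {z. y \<leadsto> z \<and> z \<leadsto> y}"
  unfolding component_of_point_def
proof (rule the_equality)
  have yy: "y \<leadsto> y" using omega_limit_points_lead_to_each_other assms by blast
  then have "y \<in> chain_recurrent_set X f" using leads_to_in by (auto simp: chain_recurrent_set_def)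
  then have "{z. y \<leadsto> z \<and> z \<leadsto> y} \<in> chain_components X f"
    using chain_class_eq[of y] unfolding chain_components_def by (metis quotientI)
  then show "{z. y \<leadsto> z \<and> z \<leadsto> y} \<in> chain_components X f \<and> omega_limit X f x \<subseteq> {z. y \<leadsto> z \<and> z \<leadsto> y}"
    using omega_limit_points_lead_to_each_other assms by blast
  fix C assume C: "C \<in> chain_components X f \<and> omega_limit X f x \<subseteq> C"
  then have "C = chain_equiv X f `` {y}"
    using assms(2) equiv_chain_equiv unfolding chain_components_def
    by (metis Image_singleton_iff equiv_class_eq quotientE subsetD)
  then show "C = {z. y \<leadsto> z \<and> z \<leadsto> y}" using chain_class_eq[of y] by simp
qed

lemma chain_stableD:
  assumes "chain_stable X f S" "\<epsilon> > 0"
  shows "\<exists>\<delta>>0. \<forall>c k. delta_chain X f \<delta> c k \<and> c 0 \<in> S \<longrightarrow> (\<forall>i\<le>k. infdist (c i) S \<le> \<epsilon>)"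
  using assms by (simp add: chain_stable_def)

text \<open>
  Chain stability confines chains with small jumps starting at \<open>y\<close> to small neighbourhoods of the
  closed component, so their limits lead nowhere else. Conversely, if nothing else is reachable from
  \<open>y\<close> then the component is \<open>reachable y\<close>, and upper semicontinuity is its stability.
\<close>

lemma terminal_component_iff:
  assumes "y \<leadsto> y"
  shows "{z. y \<leadsto> z \<and> z \<leadsto> y} \<in> terminal_components X f \<longleftrightarrow> terminal_point y"
proof
  let ?C = "{z. y \<leadsto> z \<and> z \<leadsto> y}"
  assume "?C \<in> terminal_components X f"
  then have stable: "chain_stable X f ?C" by (simp add: terminal_components_def)
  have closed: "closed ?C"
    using stable closedin_closed_trans[OF _ compact_imp_closed[OF compact_X]]
    by (simp add: chain_stable_def)
  show "terminal_point y"
    unfolding terminal_point_def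
  proof (intro conjI ballI)
    show "y \<in> X" using leads_to_in(1)[OF assms] .
    fix z assume z: "z \<in> reachable y"
    have "infdist z ?C \<le> \<epsilon>" if \<epsilon>: "\<epsilon> > 0" for \<epsilon>
    proof -
      obtain \<delta> where \<delta>: "\<delta> > 0 \<and>
          (\<forall>c k. delta_chain X f \<delta> c k \<and> c 0 \<in> ?C \<longrightarrow> (\<forall>i\<le>k. infdist (c i) ?C \<le> \<epsilon>))"
        using chain_stableD[OF stable \<epsilon>] ..
      obtain c k where c: "delta_chain X f \<delta> c k" "c 0 = y" "c k = z"
        using z \<delta> by (auto simp: reachable_def chain_to_def)
      then have "\<forall>i\<le>k. infdist (c i) ?C \<le> \<epsilon>" using \<delta> assms by simp
      then show ?thesis using c(3) by auto
    qed
    then have "infdist z ?C \<le> 0" using field_le_epsilon[of "infdist z ?C" 0] by simp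
    then have "infdist z ?C = 0" using infdist_nonneg[of z ?C] by linarith
    then have "z \<in> ?C" using in_closed_iff_infdist_zero[OF closed] assms by blast
    then show "z \<leadsto> y" by blast
  qed
next
  let ?C = "{z. y \<leadsto> z \<and> z \<leadsto> y}"
  assume "terminal_point y"
  then have C: "?C = reachable y" by (auto simp: terminal_point_def reachable_def)
  have "chain_stable X f ?C"
    unfolding chain_stable_def
  proof (intro conjI allI impI)
    show "closedin (top_of_set X) ?C"
      unfolding C using closed_subset[OF reachable_subset closed_reachable] .
    show "f ` ?C \<subseteq> ?C"
      unfolding C
    proof
      fix w assume "w \<in> f ` reachable y"
      then obtain v where "y \<leadsto> v" "w = f v" by (auto simp: reachable_def)
      then show "w \<in> reachable y"
        using leads_to_image[of v] leads_to_in[of y v] leads_to_trans[of y v w] by (simp add: reachable_def)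
    qed
    fix \<epsilon> :: real assume \<epsilon>: "\<epsilon> > 0"
    obtain \<eta> where \<eta>: "\<eta> > 0"
      "\<And>y' p z. y' \<in> reachable y \<Longrightarrow> dist p y' < \<eta> \<Longrightarrow> reach \<eta> p z
         \<Longrightarrow> \<exists>y'\<in>reachable y. \<exists>c\<in>reachable y'. dist z c < \<epsilon>"
      using reachable_upper_semicontinuous[OF compact_reachable[of y] reachable_subset \<epsilon>] by metis
    have "infdist (c i) ?C \<le> \<epsilon>" if c: "delta_chain X f \<eta> c k" "c 0 \<in> ?C" and "i \<le> k" for c k i
    proof (cases "i = 0")
      case True
      then show ?thesis using c(2) \<epsilon> by simp
    next
      case False
      then have "delta_chain X f \<eta> c i"
        using c(1) \<open>i \<le> k\<close> by (auto simp: delta_chain_def)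
      then have "reach \<eta> (c 0) (c i)" by (auto simp: reach_def)
      then obtain y' w where "y' \<in> reachable y" "w \<in> reachable y'" "dist (c i) w < \<epsilon>"
        using \<eta>(2)[of "c 0" "c 0" "c i"] c(2) \<eta>(1) unfolding C by auto
      then have "w \<in> ?C" "dist (c i) w \<le> \<epsilon>"
        unfolding C using leads_to_trans[of y y' w] by (simp_all add: reachable_def)
      then show ?thesis by (rule infdist_le2)
    qed
    then show "\<exists>\<delta>>0. \<forall>x k. delta_chain X f \<delta> x k \<and> x 0 \<in> ?C \<longrightarrow> (\<forall>i\<le>k. infdist (x i) ?C \<le> \<epsilon>)"
      using \<eta>(1) by blast
  qed
  moreover have "?C \<in> chain_components X f"
    unfolding chain_components_def chain_class_eq[symmetric]
    by (rule quotientI) (use assms leads_to_in[OF assms] in \<open>simp add: chain_recurrent_set_def\<close>)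
  ultimately show "?C \<in> terminal_components X f" by (simp add: terminal_components_def)
qed

lemma V_set_iff:
  assumes "x \<in> X" "y \<in> omega_limit X f x"
  shows "x \<in> V_set X f \<longleftrightarrow> terminal_point y"
  using assms(1) component_of_point_eq[OF assms]
    terminal_component_iff[OF omega_limit_points_lead_to_each_other[OF assms assms(2)]]
  by (simp add: V_set_def)

lemma W_set_iff:
  assumes "x \<in> X" "y \<in> omega_limit X f x"
  shows "x \<in> W_set X f \<longleftrightarrow> reachable y \<subseteq> omega_limit X f x"
proof -
  have sub: "omega_limit X f x \<subseteq> {z. y \<leadsto> z \<and> z \<leadsto> y}"
    using assms omega_limit_points_lead_to_each_other by blast
  have C: "terminal_point y \<longleftrightarrow> reachable y \<subseteq> {z. y \<leadsto> z \<and> z \<leadsto> y}"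
    using assms(2) by (auto simp: terminal_point_def reachable_def omega_limit_iff)
  have "x \<in> W_set X f \<longleftrightarrow> terminal_point y \<and> omega_limit X f x = {z. y \<leadsto> z \<and> z \<leadsto> y}"
    using V_set_iff[OF assms] component_of_point_eq[OF assms] by (auto simp: W_set_def)
  also have "\<dots> \<longleftrightarrow> reachable y \<subseteq> omega_limit X f x"
    using sub unfolding C reachable_def by blast
  finally show ?thesis .
qed

section \<open>Countable intersections of open sets\<close>

definition visits :: "nat \<Rightarrow> 'a \<Rightarrow> real \<Rightarrow> 'a set"
  where "visits n c r = {q \<in> X. \<exists>m\<ge>n. dist ((f ^^ m) q) c < r}"

lemma openin_visits: "openin (top_of_set X) (visits n c r)"
proof -
  have eq: "visits n c r = (\<Union>m\<in>{n..}. X \<inter> (f ^^ m) -` ball c r)"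
    by (auto simp: visits_def dist_commute)
  have "openin (top_of_set X) (X \<inter> (f ^^ m) -` ball c r)" for m
    by (intro continuous_openin_preimage_gen continuous_iterate) simp
  then show ?thesis unfolding eq by (intro openin_Union) blast
qed

lemma openin_tracing:
  assumes "finite F"
  shows "openin (top_of_set X) (visits 0 y \<eta> \<inter> (\<Inter>c\<in>F. visits n c \<eta>))"
  using assms
proof (induction F rule: finite_induct)
  case (insert c F)
  have "visits 0 y \<eta> \<inter> (\<Inter>c\<in>insert c F. visits n c \<eta>)
      = visits n c \<eta> \<inter> (visits 0 y \<eta> \<inter> (\<Inter>c\<in>F. visits n c \<eta>))" by auto
  then show ?case using insert.IH openin_visits by (metis openin_Int)
qed (simp add: openin_visits)

text \<open>
  The scale-\<open>n\<close> conditions for membership in \<open>V(f)\<close> and \<open>W(f)\<close>. In \<open>catches\<close> the times \<open>m \<ge> n\<close>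
  tend to infinity with the scale, so that a point approximated at all scales is an omega-limit
  point and not merely a point of the orbit.
\<close>

definition returns :: "nat \<Rightarrow> 'a set"
  where "returns n = {x \<in> X. \<exists>N. \<exists>\<delta>>0. \<forall>z. reach \<delta> ((f ^^ N) x) z \<longrightarrow>
                        reach (inverse (real (Suc n))) z ((f ^^ N) x)}"

definition catches :: "nat \<Rightarrow> 'a set"
  where "catches n = {x \<in> X. \<exists>N. \<exists>\<delta>>0. \<forall>z. reach \<delta> ((f ^^ N) x) z \<longrightarrow>
                        (\<exists>m\<ge>n. dist ((f ^^ m) x) z < inverse (real (Suc n)))}"

text \<open>
  Near a terminal point \<open>y\<close>, a chain with small jumps ends close to some \<open>c\<close> reachable from \<open>y\<close>.
  As \<open>c\<close> leads back to \<open>y\<close>, so does the end point after a small change of the first step, and a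
  small change of the last step leads back to where the chain started. Entering a neighbourhood of
  \<open>y\<close> once is thus enough, which is an open condition.
\<close>

lemma terminal_point_neighbourhood_returns:
  assumes "terminal_point y"
  obtains \<eta> where "\<eta> > 0" "visits 0 y \<eta> \<subseteq> returns n"
proof -
  define \<epsilon> where "\<epsilon> = inverse (real (Suc n))"
  have \<epsilon>: "\<epsilon> > 0" by (simp add: \<epsilon>_def)
  have y: "y \<in> X" using assms by (simp add: terminal_point_def)
  obtain \<zeta> where \<zeta>: "\<zeta> > 0" "\<zeta> \<le> \<epsilon>/3"
    "\<And>p q. p \<in> X \<Longrightarrow> q \<in> X \<Longrightarrow> dist p q < \<zeta> \<Longrightarrow> dist (f p) (f q) \<le> \<epsilon>/3"
    using uniform_modulus[of "\<epsilon>/3"] \<epsilon> by auto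
  have "compact {y}" "{y} \<subseteq> X" using y by auto
  then obtain \<eta> where \<eta>: "\<eta> > 0"
    "\<And>y' p z. y' \<in> {y} \<Longrightarrow> dist p y' < \<eta> \<Longrightarrow> reach \<eta> p z \<Longrightarrow> \<exists>y'\<in>{y}. \<exists>c\<in>reachable y'. dist z c < \<zeta>"
    using reachable_upper_semicontinuous[OF _ _ \<zeta>(1)] by metis
  have "visits 0 y (min \<eta> \<zeta>) \<subseteq> returns n"
  proof
    fix q assume "q \<in> visits 0 y (min \<eta> \<zeta>)"
    then obtain N where q: "q \<in> X" "dist ((f ^^ N) q) y < \<eta>" "dist ((f ^^ N) q) y < \<zeta>"
      by (auto simp: visits_def)
    let ?p = "(f ^^ N) q"
    have "reach \<epsilon> z ?p" if z: "reach \<eta> ?p z" for z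
    proof -
      obtain c where c: "c \<in> reachable y" "dist z c < \<zeta>" using \<eta>(2) q(2) z by blast
      have "c \<leadsto> y" using assms c(1) by (simp add: terminal_point_def)
      then have "reach (\<epsilon>/3) c y" using \<epsilon> by (simp add: leads_to_iff)
      then have "reach (\<epsilon>/3 + \<epsilon>/3) z y"
        using \<zeta>(3)[of z c] c reachable_subset reach_in(2)[OF z] \<epsilon>
        by (intro reach_perturb_start) auto
      then have "reach (\<epsilon>/3 + \<epsilon>/3 + \<epsilon>/3) z ?p"
        by (rule reach_perturb_end)
           (use q \<zeta>(2) \<epsilon> iterate_in[OF q(1)] in \<open>auto simp: dist_commute\<close>)
      then show ?thesis by simp
    qed
    then show "q \<in> returns n" using q(1) \<eta>(1) unfolding returns_def \<epsilon>_def by blast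
  qed
  then show ?thesis using that[of "min \<eta> \<zeta>"] \<eta>(1) \<zeta>(1) by simp
qed

text \<open>
  An orbit that comes close to \<open>y\<close> once, and to each point of a finite net of \<open>reachable y\<close> at a
  late time, already satisfies the \<open>n\<close>-th condition: chains with small jumps starting near \<open>y\<close> end
  near \<open>reachable y\<close>, hence near a point of the net. Passing to a net turns infinitely many
  requirements on the orbit into an open condition that one finite pseudo-orbit can meet.
\<close>

lemma tracing_net_catches:
  assumes "y \<in> X"
  obtains F \<eta> where "finite F" "F \<subseteq> reachable y" "\<eta> > 0"
    "visits 0 y \<eta> \<inter> (\<Inter>c\<in>F. visits n c \<eta>) \<subseteq> catches n"
proof -
  define \<epsilon> where "\<epsilon> = inverse (real (Suc n))"
  have \<epsilon>: "\<epsilon> > 0" by (simp add: \<epsilon>_def)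
  have "compact {y}" "{y} \<subseteq> X" "\<epsilon>/3 > 0" using assms \<epsilon> by auto
  then obtain \<eta> where \<eta>: "\<eta> > 0"
    "\<And>y' p z. y' \<in> {y} \<Longrightarrow> dist p y' < \<eta> \<Longrightarrow> reach \<eta> p z \<Longrightarrow> \<exists>y'\<in>{y}. \<exists>c\<in>reachable y'. dist z c < \<epsilon>/3"
    using reachable_upper_semicontinuous by metis
  obtain F where F: "finite F" "F \<subseteq> reachable y" "reachable y \<subseteq> (\<Union>c\<in>F. ball c (\<epsilon>/3))"
    using seq_compact_imp_totally_bounded[OF compact_imp_seq_compact[OF compact_reachable[of y]]] \<epsilon>
    by (meson \<open>\<epsilon>/3 > 0\<close>)
  define \<zeta> where "\<zeta> = min \<eta> (\<epsilon>/3)"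
  have "visits 0 y \<zeta> \<inter> (\<Inter>c\<in>F. visits n c \<zeta>) \<subseteq> catches n"
  proof
    fix q assume q: "q \<in> visits 0 y \<zeta> \<inter> (\<Inter>c\<in>F. visits n c \<zeta>)"
    then obtain N where N: "q \<in> X" "dist ((f ^^ N) q) y < \<eta>" by (auto simp: visits_def \<zeta>_def)
    have "\<exists>m\<ge>n. dist ((f ^^ m) q) z < \<epsilon>" if z: "reach \<eta> ((f ^^ N) q) z" for z
    proof -
      obtain c where c: "c \<in> reachable y" "dist z c < \<epsilon>/3" using \<eta>(2) N(2) z by blast
      obtain d where d: "d \<in> F" "dist d c < \<epsilon>/3" using F(3) c(1) by auto
      obtain m where m: "m \<ge> n" "dist ((f ^^ m) q) d < \<epsilon>/3"
        using q d(1) by (auto simp: visits_def \<zeta>_def)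
      have "dist ((f ^^ m) q) z < \<epsilon>"
        using dist_triangle[of "(f ^^ m) q" z d] dist_triangle2[of d z c] c d m by linarith
      then show ?thesis using m(1) by blast
    qed
    then show "q \<in> catches n" using N(1) \<eta>(1) unfolding catches_def \<epsilon>_def by blast
  qed
  then show ?thesis using that[of F \<zeta>] F \<eta>(1) \<epsilon> by (simp add: \<zeta>_def)
qed

lemma in_visits_of_omega_limit:
  assumes "x \<in> X" "y \<in> omega_limit X f x" "\<eta> > 0"
  shows "x \<in> visits n y \<eta>"
  using assms by (auto simp: visits_def omega_limit_iff)

text \<open>
  If \<open>x\<close> satisfies all conditions and \<open>y \<leadsto> z\<close> for an omega-limit point \<open>y\<close> of \<open>x\<close>, then each
  iterate \<open>p\<close> of \<open>x\<close> leads to \<open>y\<close> and on to \<open>z\<close>; the chains back from \<open>z\<close> to \<open>p\<close> can be continued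
  to \<open>y\<close>.
\<close>

lemma V_set_eq: "V_set X f = (\<Inter>n. top_of_set X interior_of returns n)"
proof
  show "V_set X f \<subseteq> (\<Inter>n. top_of_set X interior_of returns n)"
  proof (intro subsetI INT_I)
    fix x n assume x: "x \<in> V_set X f"
    then have "x \<in> X" by (simp add: V_set_def)
    then obtain y where y: "y \<in> omega_limit X f x" using omega_limit_nonempty by blast
    obtain \<eta> where "\<eta> > 0" "visits 0 y \<eta> \<subseteq> returns n"
      using terminal_point_neighbourhood_returns V_set_iff[OF \<open>x \<in> X\<close> y] x by blast
    then show "x \<in> top_of_set X interior_of returns n"
      using in_visits_of_omega_limit[OF \<open>x \<in> X\<close> y] interior_of_maximal[OF _ openin_visits] by blast
  qed
  show "(\<Inter>n. top_of_set X interior_of returns n) \<subseteq> V_set X f"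
  proof
    fix x assume "x \<in> (\<Inter>n. top_of_set X interior_of returns n)"
    then have x: "x \<in> returns n" for n
      using interior_of_subset[of "top_of_set X" "returns n"] by blast
    then have "x \<in> X" by (simp add: returns_def)
    then obtain y where y: "y \<in> omega_limit X f x" using omega_limit_nonempty by blast
    have "z \<leadsto> y" if z: "z \<in> reachable y" for z
      unfolding leads_to_iff
    proof (intro allI impI)
      fix \<epsilon> :: real assume \<epsilon>: "\<epsilon> > 0"
      then obtain n where n: "inverse (real (Suc n)) < \<epsilon>" using reals_Archimedean by blast
      obtain N \<delta> where \<delta>: "\<delta> > 0" "\<And>z. reach \<delta> ((f ^^ N) x) z \<Longrightarrow>
          reach (inverse (real (Suc n))) z ((f ^^ N) x)"
        using x[of n] by (auto simp: returns_def)
      have xy: "(f ^^ N) x \<leadsto> y" using iterate_leads_to_omega_limit \<open>x \<in> X\<close> y by blast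
      then have "(f ^^ N) x \<leadsto> z" using z leads_to_trans by (auto simp: reachable_def)
      then have "reach \<epsilon> z ((f ^^ N) x)"
        using \<delta> n reach_mono by (meson leads_to_iff less_imp_le)
      then show "reach \<epsilon> z y" using xy \<epsilon> reach_trans by (meson leads_to_iff)
    qed
    moreover have "y \<in> X" using y omega_limit_iff by blast
    ultimately show "x \<in> V_set X f"
      using V_set_iff[OF \<open>x \<in> X\<close> y] by (simp add: terminal_point_def)
  qed
qed

lemma W_set_eq: "W_set X f = (\<Inter>n. top_of_set X interior_of catches n)"
proof
  show "W_set X f \<subseteq> (\<Inter>n. top_of_set X interior_of catches n)"
  proof (intro subsetI INT_I)
    fix x n assume x: "x \<in> W_set X f"
    then have "x \<in> X" by (simp add: W_set_def V_set_def)
    then obtain y where y: "y \<in> omega_limit X f x" using omega_limit_nonempty by blast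
    then have "y \<in> X" using omega_limit_iff by blast
    then obtain F \<eta> where F: "finite F" "F \<subseteq> reachable y" "\<eta> > 0"
      "visits 0 y \<eta> \<inter> (\<Inter>c\<in>F. visits n c \<eta>) \<subseteq> catches n"
      using tracing_net_catches by blast
    have "F \<subseteq> omega_limit X f x" using F(2) W_set_iff[OF \<open>x \<in> X\<close> y] x by blast
    then have "x \<in> visits 0 y \<eta> \<inter> (\<Inter>c\<in>F. visits n c \<eta>)"
      using in_visits_of_omega_limit[OF \<open>x \<in> X\<close> _ F(3)] y by blast
    moreover have "openin (top_of_set X) (visits 0 y \<eta> \<inter> (\<Inter>c\<in>F. visits n c \<eta>))"
      using openin_tracing[OF F(1)] .
    ultimately show "x \<in> top_of_set X interior_of catches n"
      using interior_of_maximal[OF F(4)] by blast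
  qed
  show "(\<Inter>n. top_of_set X interior_of catches n) \<subseteq> W_set X f"
  proof
    fix x assume "x \<in> (\<Inter>n. top_of_set X interior_of catches n)"
    then have x: "x \<in> catches n" for n
      using interior_of_subset[of "top_of_set X" "catches n"] by blast
    then have "x \<in> X" by (simp add: catches_def)
    then obtain y where y: "y \<in> omega_limit X f x" using omega_limit_nonempty by blast
    have "z \<in> omega_limit X f x" if z: "z \<in> reachable y" for z
      unfolding omega_limit_iff
    proof (intro conjI allI impI)
      show "z \<in> X" using z reachable_subset by blast
      fix \<epsilon> :: real and n :: nat assume "\<epsilon> > 0"
      then obtain k where k: "inverse (real (Suc k)) < \<epsilon>" using reals_Archimedean by blast
      \<comment> \<open>One scale that is both fine enough for \<open>\<epsilon>\<close> and late enough for \<open>n\<close>.\<close>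
      let ?m = "max n k"
      obtain N \<delta> where \<delta>: "\<delta> > 0" "\<And>z. reach \<delta> ((f ^^ N) x) z \<Longrightarrow>
          \<exists>m\<ge>?m. dist ((f ^^ m) x) z < inverse (real (Suc ?m))"
        using x[of ?m] unfolding catches_def by blast
      have "(f ^^ N) x \<leadsto> z"
        using iterate_leads_to_omega_limit[OF \<open>x \<in> X\<close> y] z leads_to_trans by (auto simp: reachable_def)
      then obtain m where m: "m \<ge> ?m" "dist ((f ^^ m) x) z < inverse (real (Suc ?m))"
        using \<delta> leads_to_iff by blast
      have "inverse (real (Suc ?m)) \<le> inverse (real (Suc k))"
        by (intro le_imp_inverse_le) auto
      then show "\<exists>m\<ge>n. dist ((f ^^ m) x) z < \<epsilon>"
        using m k by (intro exI[of _ m] conjI) linarith+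
    qed
    then show "x \<in> W_set X f" using W_set_iff[OF \<open>x \<in> X\<close> y] by blast
  qed
qed

section \<open>Density from shadowing\<close>

text \<open>
  Since each chain has positive length, going round from \<open>y\<close> to \<open>y\<close> often enough delays the tour
  through \<open>F\<close> beyond time \<open>n\<close>.
\<close>

lemma touring_chain:
  assumes "\<delta> > 0" "x \<leadsto> y" "y \<leadsto> y" "finite F" "\<And>z. z \<in> F \<Longrightarrow> y \<leadsto> z \<and> z \<leadsto> y"
  shows "\<exists>c k. delta_chain X f \<delta> c k \<and> c 0 = x \<and> c k = y \<and> n \<le> k \<and> (\<forall>z\<in>F. \<exists>j\<in>{n..k}. c j = z)"
  using assms(4,5)
proof (induction F rule: finite_induct)
  case empty
  have "\<exists>c k. delta_chain X f \<delta> c k \<and> c 0 = x \<and> c k = y \<and> n \<le> k"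
  proof (induction n)
    case 0
    then show ?case using assms(1,2) by (auto simp: chain_to_def)
  next
    case (Suc n)
    then obtain c k where c: "delta_chain X f \<delta> c k" "c 0 = x" "c k = y" "n \<le> k" by blast
    obtain d l where d: "delta_chain X f \<delta> d l" "d 0 = y" "d l = y"
      using assms(1,3) by (auto simp: chain_to_def)
    have "l > 0" using d(1) by (simp add: delta_chain_def)
    then show ?case
      using chain_concat[OF c(1) d(1)] c d
      by (intro exI[of _ "\<lambda>i. if i \<le> k then c i else d (i - k)"] exI[of _ "k + l"]) auto
  qed
  then show ?case by simp
next
  case (insert z F)
  then obtain c k where c: "delta_chain X f \<delta> c k" "c 0 = x" "c k = y" "n \<le> k"
    "\<And>w. w \<in> F \<Longrightarrow> \<exists>j\<in>{n..k}. c j = w"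
    by auto
  obtain d l where d: "delta_chain X f \<delta> d l" "d 0 = y" "d l = z"
    using assms(1) insert.prems[of z] by (auto simp: chain_to_def)
  obtain e m where e: "delta_chain X f \<delta> e m" "e 0 = z" "e m = y"
    using assms(1) insert.prems[of z] by (auto simp: chain_to_def)
  define c1 where "c1 = (\<lambda>i. if i \<le> k then c i else d (i - k))"
  define c2 where "c2 = (\<lambda>i. if i \<le> k + l then c1 i else e (i - (k + l)))"
  have pos: "l > 0" "m > 0" using d(1) e(1) by (simp_all add: delta_chain_def)
  have c1: "delta_chain X f \<delta> c1 (k + l)" "c1 (k + l) = z"
    using chain_concat[OF c(1) d(1)] c d pos by (auto simp: c1_def)
  have "delta_chain X f \<delta> c2 (k + l + m)"
    using chain_concat[OF c1(1) e(1)] c1(2) e(2) by (simp add: c2_def)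
  moreover have "c2 0 = x" "c2 (k + l + m) = y"
    using c(2) e(3) pos by (auto simp: c2_def c1_def)
  moreover have "\<exists>j\<in>{n..k + l + m}. c2 j = w" if w: "w \<in> insert z F" for w
  proof (cases "w = z")
    case True
    then show ?thesis using c1(2) c(4) by (intro bexI[of _ "k + l"]) (auto simp: c2_def)
  next
    case False
    then obtain j where "j \<in> {n..k}" "c j = w" using w c(5) by blast
    then show ?thesis by (intro bexI[of _ j]) (auto simp: c2_def c1_def)
  qed
  ultimately show ?case using c(4) by (intro exI[of _ c2] exI[of _ "k + l + m"]) auto
qed

lemma pseudo_orbit_extending_chain:
  assumes "delta_chain X f \<delta> c k" "\<delta> \<ge> 0"
  shows "pseudo_orbit X f \<delta> (\<lambda>i. if i \<le> k then c i else (f ^^ (i - k)) (c k))"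
  unfolding pseudo_orbit_def
proof (intro conjI allI)
  fix i
  have "c k \<in> X" using assms by (simp add: delta_chain_def)
  then show "(if i \<le> k then c i else (f ^^ (i - k)) (c k)) \<in> X"
    using assms iterate_in by (auto simp: delta_chain_def)
  consider "i < k" | "i \<ge> k" by linarith
  then show "dist (f (if i \<le> k then c i else (f ^^ (i - k)) (c k)))
      (if Suc i \<le> k then c (Suc i) else (f ^^ (Suc i - k)) (c k)) \<le> \<delta>"
    using assms by cases (auto simp: delta_chain_def Suc_diff_le)
qed

text \<open>
  The shadowing point imitates a chain from \<open>x\<close> to a terminal \<open>y\<close> that tours a net of
  \<open>reachable y\<close>; such a tour exists because terminality makes every point of the net lead back
  to \<open>y\<close>.
\<close>

lemma dense_interior_catches:
  assumes "shadowing_property X f"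
  shows "top_of_set X closure_of (top_of_set X interior_of catches n) = X"
proof -
  have "(top_of_set X interior_of catches n) \<inter> T \<noteq> {}"
    if T: "openin (top_of_set X) T" "T \<noteq> {}" for T
  proof -
    obtain x where "x \<in> T" using T by blast
    then obtain r where r: "x \<in> X" "r > 0" "\<And>q. q \<in> X \<Longrightarrow> dist q x < r \<Longrightarrow> q \<in> T"
      using T(1) unfolding openin_euclidean_subtopology_iff by blast
    obtain y where y: "x \<leadsto> y" "terminal_point y" using terminal_point_reachable r(1) by blast
    then have "y \<in> X" by (simp add: terminal_point_def)
    then obtain F \<eta> where F: "finite F" "F \<subseteq> reachable y" "\<eta> > 0"
      "visits 0 y \<eta> \<inter> (\<Inter>c\<in>F. visits n c \<eta>) \<subseteq> catches n"
      using tracing_net_catches by blast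
    \<comment> \<open>Shadowing within \<open>r\<close> keeps the point in \<open>T\<close>; within \<open>\<eta>\<close>, it makes the point visit \<open>y\<close> and the
      net. The shadowing bound is non-strict, whence the factor.\<close>
    define \<epsilon> where "\<epsilon> = min \<eta> r / 2"
    have \<epsilon>: "\<epsilon> > 0" "\<epsilon> < \<eta>" "\<epsilon> < r" using F(3) r(2) by (auto simp: \<epsilon>_def)
    then obtain \<delta> where \<delta>: "\<delta> > 0"
      "\<And>s. pseudo_orbit X f \<delta> s \<Longrightarrow> \<exists>p\<in>X. shadowed_by f \<epsilon> s p"
      using assms unfolding shadowing_property_def by meson
    have "\<And>z. z \<in> F \<Longrightarrow> y \<leadsto> z \<and> z \<leadsto> y"
      using F(2) y(2) by (auto simp: terminal_point_def reachable_def)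
    then obtain c k where c: "delta_chain X f \<delta> c k" "c 0 = x" "c k = y"
      "\<And>z. z \<in> F \<Longrightarrow> \<exists>j\<in>{n..k}. c j = z"
      using touring_chain[OF \<delta>(1) y(1) terminal_point_recurrent[OF y(2)] F(1), of n] by blast
    obtain q where q: "q \<in> X" "shadowed_by f \<epsilon> (\<lambda>i. if i \<le> k then c i else (f ^^ (i - k)) (c k)) q"
      using \<delta>(2)[OF pseudo_orbit_extending_chain[OF c(1)]] \<delta>(1) by auto
    have near: "dist ((f ^^ i) q) (c i) \<le> \<epsilon>" if "i \<le> k" for i
      using q(2) that unfolding shadowed_by_def by (metis (mono_tags, lifting))
    have "dist ((f ^^ k) q) y < \<eta>" using near[of k] c(3) \<epsilon>(2) by simp
    then have "q \<in> visits 0 y \<eta>" using q(1) by (auto simp: visits_def)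
    moreover have "q \<in> visits n z \<eta>" if z: "z \<in> F" for z
    proof -
      obtain j where j: "j \<in> {n..k}" "c j = z" using c(4)[OF z] by blast
      then have "dist ((f ^^ j) q) z < \<eta>" using near[of j] \<epsilon>(2) by simp
      then show ?thesis using j(1) q(1) by (auto simp: visits_def)
    qed
    ultimately have "q \<in> top_of_set X interior_of catches n"
      using interior_of_maximal[OF F(4) openin_tracing[OF F(1)]] by blast
    moreover have "q \<in> T" using near[of 0] c(2) \<epsilon>(3) q(1) r(3) by simp
    ultimately show ?thesis by blast
  qed
  then show ?thesis
    using dense_intersects_open[of "top_of_set X" "top_of_set X interior_of catches n"] by auto
qed

lemma dense_W_set:
  assumes "shadowing_property X f"
  shows "top_of_set X closure_of W_set X f = X"
proof -
  have "compact_space (top_of_set X)"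
    using compact_X by (simp add: compact_space_subtopology)
  moreover have "Hausdorff_space (top_of_set X)"
    by (simp add: Hausdorff_space_subtopology)
  ultimately have "locally_compact_space (top_of_set X) \<and> regular_space (top_of_set X)"
    using compact_imp_locally_compact_space compact_Hausdorff_imp_regular_space by blast
  then have "top_of_set X closure_of \<Inter>(range (\<lambda>n. top_of_set X interior_of catches n))
      = topspace (top_of_set X)"
    using dense_interior_catches[OF assms] by (intro Baire_category) auto
  then show ?thesis by (simp add: W_set_eq)
qed

lemma dense_V_set:
  assumes "shadowing_property X f"
  shows "top_of_set X closure_of V_set X f = X"
proof -
  have "W_set X f \<subseteq> V_set X f" by (auto simp: W_set_def)
  then show ?thesis
    using closure_of_mono[of "W_set X f" "V_set X f" "top_of_set X"] dense_W_set[OF assms]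
      closure_of_subset_topspace[of "top_of_set X" "V_set X f"] by auto
qed

lemma gdelta_INT_interior:
  "gdelta_in (top_of_set X) (\<Inter>n::nat. top_of_set X interior_of (S n))"
  by (rule gdelta_in_Inter) (auto intro: open_imp_gdelta_in)

end

theorem theorem1p1:
  fixes X :: "'a::metric_space set" and f :: "'a \<Rightarrow> 'a"
  assumes "compact X"
    and "continuous_on X f"
    and "f ` X \<subseteq> X"
    and "shadowing_property X f"
  shows "gdelta_in (top_of_set X) (V_set X f) \<and> top_of_set X closure_of (V_set X f) = X \<and>
         gdelta_in (top_of_set X) (W_set X f) \<and> top_of_set X closure_of (W_set X f) = X"
proof -
  interpret compact_system X f using assms by unfold_locales
  show ?thesis
    using gdelta_INT_interior[of returns] gdelta_INT_interior[of catches]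
      dense_V_set[OF assms(4)] dense_W_set[OF assms(4)]
    by (simp flip: V_set_eq W_set_eq)
qed

end
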